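(* Let $C$ be a proper convex subset of $\mathbb R^m$, $m\in\mathbb N$. Then $C\in\mathcal C_m^0$ holds if and only if every atom of $\mathcal N_C$ is a ray. In that case the antitone lattice isomorphism $N_C:\mathcal E_C\to\mathcal N_C$, $F\mapsto N_C(F)$, restricts to a bijection from the set of coatoms of $\mathcal E_C$ to the set of normal cones of $C$ which are rays.
   Context: $\mathbb R^m$ carries the standard inner product $\langle\cdot,\cdot\rangle$. The relative interior of a convex set is its interior in its affine hull. For a convex set $C\subset\mathbb R^m$ the normal cone of $C$ at $x\in C$ is $N_C(x):=\{u\in\mathbb R^m\mid \forall y\in C:\ \langle u,y-x\rangle\le 0\}$. For a non-empty convex subset $F\subset C$, $N_C(F):=N_C(x)$ for any relative interior point $x$ of $F$ (well-defined), and $N_C(\emptyset):=\mathbb R^m$. $\mathcal N_C$ denotes the set of normal cones of $C$ at points of $C$ together with $N_C(\emptyset)=\mathbb R^m$. A proper normal cone of $C$ is an element of $\mathcal N_C$ other than $N_C(\emptyset)$ and $N_C(C)$. An exposed face of a convex set is either the empty set or the set of minimizers of a linear form on it (the zero form is allowed, so the whole set is an exposed face). $\mathcal E_C$ is the set of exposed faces of $C$. Ordered by inclusion, $\mathcal E_C$ and $\mathcal N_C$ are complete lattices with intersection as infimum, and if $C$ is not a singleton then $N_C:\mathcal E_C\to\mathcal N_C$ is an antitone lattice isomorphism. A proper exposed face of $C$ is an $F\in\mathcal E_C$ with $F\ne\emptyset$ and $F\ne C$. A proper convex subset of $\mathbb R^m$ is a convex subset of $\mathbb R^m$ with interior points which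 has a proper exposed face; for such $C$ the smallest element of $\mathcal N_C$ is $N_C(C)=\{0\}$. A coatom of $\mathcal E_C$ is an inclusion-maximal element of $\mathcal E_C\setminus\{C\}$; an atom of $\mathcal N_C$ is an inclusion-minimal element of $\mathcal N_C\setminus\{\{0\}\}$. A ray is a set $\{\alpha u\mid\alpha\ge0\}$ with $u\neq0$; an exposed ray of a convex cone is an exposed face of it which is a ray. $\mathcal C_m^0$ is the class of proper convex subsets $C$ of $\mathbb R^m$ such that every proper normal cone $N$ of $C$ has an exposed ray which is in $\mathcal N_C$. *)

theory Defs
  imports "HOL-Analysis.Analysis"
begin

definition normal_cone_at :: "'a::euclidean_space set \<Rightarrow> 'a \<Rightarrow> 'a set" where
  "normal_cone_at C x = {u. \<forall>y\<in>C. u \<bullet> (y - x) \<le> 0}"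

text \<open>Only meaningful for \<open>x \<in> C\<close>, and below only for convex \<open>F \<subseteq> C\<close>; the choice of the relative
  interior point is then immaterial, see \<open>normal_cone_eq\<close>.\<close>

definition normal_cone :: "'a::euclidean_space set \<Rightarrow> 'a set \<Rightarrow> 'a set" where
  "normal_cone C F =
    (if F = {} then UNIV else normal_cone_at C (SOME x. x \<in> rel_interior F))"

lemma normal_cone_at_rel_interior_subset:
  assumes "convex F" "F \<subseteq> C" "x \<in> rel_interior F" "z \<in> F"
  shows "normal_cone_at C x \<subseteq> normal_cone_at C z"
proof
  fix u assume u: "u \<in> normal_cone_at C x"
  have "F \<noteq> {}"
    using assms(4) by auto
  then obtain e where e: "e > 1" "(1 - e) *\<^sub>R z + e *\<^sub>R x \<in> F"
    using assms convex_rel_interior_iff[of F x] by blast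
  have "u \<bullet> (((1 - e) *\<^sub>R z + e *\<^sub>R x) - x) \<le> 0"
    using u e assms(2) unfolding normal_cone_at_def by blast
  then have "(e - 1) * (u \<bullet> (x - z)) \<le> 0"
    by (simp add: inner_diff_right inner_add_right algebra_simps)
  with e have "u \<bullet> (x - z) \<le> 0"
    by (simp add: mult_le_0_iff)
  then have "u \<bullet> x \<le> u \<bullet> z"
    by (simp add: inner_diff_right)
  then show "u \<in> normal_cone_at C z"
    using u unfolding normal_cone_at_def by (force simp: inner_diff_right)
qed

lemma normal_cone_eq:
  assumes "convex F" "F \<subseteq> C" "x \<in> rel_interior F"
  shows "normal_cone C F = normal_cone_at C x"
proof -
  have ne: "F \<noteq> {}"
    using assms by auto
  let ?z = "SOME x. x \<in> rel_interior F"
  have z: "?z \<in> rel_interior F"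
    using assms(3) by (rule someI)
  have "normal_cone_at C ?z = normal_cone_at C x"
    using normal_cone_at_rel_interior_subset[OF assms(1,2)] z assms(3) rel_interior_subset
    by blast
  with ne show ?thesis
    by (simp add: normal_cone_def)
qed

definition normal_cones :: "'a::euclidean_space set \<Rightarrow> 'a set set" where
  "normal_cones C = insert (normal_cone C {}) (normal_cone_at C ` C)"

definition proper_normal_cone :: "'a::euclidean_space set \<Rightarrow> 'a set \<Rightarrow> bool" where
  "proper_normal_cone C N \<longleftrightarrow>
    N \<in> normal_cones C \<and> N \<noteq> normal_cone C {} \<and> N \<noteq> normal_cone C C"

definition exposed_faces :: "'a::euclidean_space set \<Rightarrow> 'a set set" where
  "exposed_faces C = {F. F exposed_face_of C}"

text \<open>The library predicate agrees with the definition through minimizers of linear forms.\<close>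

lemma exposed_face_of_iff_minimizers:
  fixes C :: "'a::euclidean_space set"
  assumes "convex C"
  shows "F exposed_face_of C \<longleftrightarrow>
    F = {} \<or> (\<exists>f :: 'a \<Rightarrow> real. linear f \<and> F = {x \<in> C. \<forall>y\<in>C. f x \<le> f y})"
proof
  assume "F exposed_face_of C"
  then obtain a b where ab: "C \<subseteq> {x. a \<bullet> x \<le> b}" "F = C \<inter> {x. a \<bullet> x = b}"
    unfolding exposed_face_of_def by blast
  show "F = {} \<or> (\<exists>f :: 'a \<Rightarrow> real. linear f \<and> F = {x \<in> C. \<forall>y\<in>C. f x \<le> f y})"
  proof (cases "F = {}")
    case False
    then obtain z where z: "z \<in> C" "a \<bullet> z = b"
      using ab by auto
    have "linear (\<lambda>x. (- a) \<bullet> x)"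
      by (rule linearI) (simp_all add: inner_add_right)
    moreover have "F = {x \<in> C. \<forall>y\<in>C. (- a) \<bullet> x \<le> (- a) \<bullet> y}"
    proof (intro set_eqI iffI)
      fix x assume "x \<in> F"
      then show "x \<in> {x \<in> C. \<forall>y\<in>C. (- a) \<bullet> x \<le> (- a) \<bullet> y}"
        using ab by auto
    next
      fix x assume x: "x \<in> {x \<in> C. \<forall>y\<in>C. (- a) \<bullet> x \<le> (- a) \<bullet> y}"
      then have "(- a) \<bullet> x \<le> (- a) \<bullet> z"
        using z(1) by blast
      moreover have "a \<bullet> x \<le> b"
        using x ab(1) by blast
      ultimately show "x \<in> F"
        using x ab(2) z(2) by simp
    qed
    ultimately show ?thesis by blast
  qed simp
next
  assume "F = {} \<or> (\<exists>f :: 'a \<Rightarrow> real. linear f \<and> F = {x \<in> C. \<forall>y\<in>C. f x \<le> f y})"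
  then show "F exposed_face_of C"
  proof
    assume "F = {}"
    then show ?thesis by simp
  next
    assume "\<exists>f :: 'a \<Rightarrow> real. linear f \<and> F = {x \<in> C. \<forall>y\<in>C. f x \<le> f y}"
    then obtain f :: "'a \<Rightarrow> real"
      where f: "linear f" "F = {x \<in> C. \<forall>y\<in>C. f x \<le> f y}" by blast
    define a where "a = adjoint f 1"
    have a: "f x = a \<bullet> x" for x
      using adjoint_works[OF f(1), of x 1] by (simp add: a_def inner_commute)
    show ?thesis
    proof (cases "F = {}")
      case False
      then obtain z where z: "z \<in> C" "\<forall>y\<in>C. a \<bullet> z \<le> a \<bullet> y"
        using f a by auto
      have "F = C \<inter> {x. a \<bullet> x = a \<bullet> z}"
      proof (intro set_eqI iffI)
        fix x assume x: "x \<in> F"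
        then have "a \<bullet> x \<le> a \<bullet> z"
          using f(2) z(1) unfolding a by blast
        moreover have "x \<in> C"
          using x f(2) by blast
        ultimately show "x \<in> C \<inter> {x. a \<bullet> x = a \<bullet> z}"
          using z(2) by (simp add: antisym)
      next
        fix x assume "x \<in> C \<inter> {x. a \<bullet> x = a \<bullet> z}"
        then show "x \<in> F"
          using f(2) z(2) unfolding a by simp
      qed
      moreover have "(C \<inter> {x. a \<bullet> x = a \<bullet> z}) exposed_face_of C"
        using exposed_face_of_Int_supporting_hyperplane_ge[OF assms] z(2) by auto
      ultimately show ?thesis by simp
    qed simp
  qed
qed

definition proper_exposed_face :: "'a::euclidean_space set \<Rightarrow> 'a set \<Rightarrow> bool" where
  "proper_exposed_face C F \<longleftrightarrow> F \<in> exposed_faces C \<and> F \<noteq> {} \<and> F \<noteq> C"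

definition proper_convex :: "'a::euclidean_space set \<Rightarrow> bool" where
  "proper_convex C \<longleftrightarrow> convex C \<and> interior C \<noteq> {} \<and> (\<exists>F. proper_exposed_face C F)"

definition exposed_face_coatom :: "'a::euclidean_space set \<Rightarrow> 'a set \<Rightarrow> bool" where
  "exposed_face_coatom C F \<longleftrightarrow>
    F \<in> exposed_faces C - {C} \<and> (\<forall>G \<in> exposed_faces C - {C}. F \<subseteq> G \<longrightarrow> G = F)"

text \<open>For proper convex \<open>C\<close>, the least normal cone is \<open>{0}\<close>.\<close>

definition normal_cone_atom :: "'a::euclidean_space set \<Rightarrow> 'a set \<Rightarrow> bool" where
  "normal_cone_atom C N \<longleftrightarrow>
    N \<in> normal_cones C - {{0}} \<and> (\<forall>M \<in> normal_cones C - {{0}}. M \<subseteq> N \<longrightarrow> M = N)"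

definition is_ray :: "'a::euclidean_space set \<Rightarrow> bool" where
  "is_ray R \<longleftrightarrow> (\<exists>u. u \<noteq> 0 \<and> R = {\<alpha> *\<^sub>R u |\<alpha>. 0 \<le> \<alpha>})"

definition exposed_ray :: "'a::euclidean_space set \<Rightarrow> 'a set \<Rightarrow> bool" where
  "exposed_ray N R \<longleftrightarrow> R \<in> exposed_faces N \<and> is_ray R"

definition class_C0 :: "'a::euclidean_space set set" where
  "class_C0 = {C. proper_convex C \<and>
    (\<forall>N. proper_normal_cone C N \<longrightarrow> (\<exists>R. exposed_ray N R \<and> R \<in> normal_cones C))}"

end

theory Submission
  imports Defs
begin

text \<open>
  The equivalence rests on the fact that a normal cone contained in another normal cone is
  automatically an exposed face of it (\<open>normal_cone_at_subset_exposed_face\<close>): if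
  \<open>N(x) \<subseteq> N(y)\<close>, then the linear form given by \<open>x - y\<close> is nonpositive on \<open>N(y)\<close> and vanishes
  there exactly on \<open>N(x)\<close>. So the dimension drops strictly along chains of normal cones, whence
  every proper normal cone contains an atom (\<open>normal_cone_atom_below\<close>), which is an exposed face
  of it. If all atoms are rays, this atom is the required exposed ray. Conversely, an exposed ray
  of an atom which is itself a normal cone must equal the atom by minimality.

  For the bijection, the exposed face belonging to a normal cone \<open>N(y)\<close> which is a ray through
  \<open>v\<close> is cut out by the supporting hyperplane orthogonal to \<open>v\<close> through \<open>y\<close>. It is a coatom,
  because any other hyperplane supporting \<open>C\<close> at \<open>y\<close> has its normal vector in \<open>N(y)\<close> and so is the
  same hyperplane. In the other direction, the normal cone of a coatom \<open>F\<close> contains a ray which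
  is a normal cone; the hyperplane orthogonal to this ray cuts out an exposed face containing
  \<open>F\<close>, hence equal to \<open>F\<close>, and this forces the normal cone of \<open>F\<close> to be the ray. Injectivity holds
  since an exposed face \<open>F\<close> with normal cone \<open>N\<close> consists of all points of \<open>C\<close> at which the
  normal cone contains \<open>N\<close>.
\<close>

section \<open>Normal cones at points\<close>

lemma normal_cone_atD: "u \<in> normal_cone_at C x \<Longrightarrow> y \<in> C \<Longrightarrow> u \<bullet> y \<le> u \<bullet> x"
  unfolding normal_cone_at_def by (auto simp: inner_diff_right)

lemma normal_cone_atI: "(\<And>y. y \<in> C \<Longrightarrow> u \<bullet> y \<le> u \<bullet> x) \<Longrightarrow> u \<in> normal_cone_at C x"
  unfolding normal_cone_at_def by (auto simp: inner_diff_right)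

lemma zero_in_normal_cone_at: "0 \<in> normal_cone_at C x"
  by (simp add: normal_cone_at_def)

lemma scaleR_in_normal_cone_at:
  "u \<in> normal_cone_at C x \<Longrightarrow> 0 \<le> \<alpha> \<Longrightarrow> \<alpha> *\<^sub>R u \<in> normal_cone_at C x"
  by (auto intro!: normal_cone_atI mult_left_mono dest: normal_cone_atD)

lemma convex_normal_cone_at: "convex (normal_cone_at C x)"
  unfolding convex_def
  by (auto intro!: normal_cone_atI add_mono mult_left_mono dest: normal_cone_atD
      simp: inner_add_left)

lemma normal_cone_at_interior:
  assumes "x \<in> interior C"
  shows "normal_cone_at C x = {0}"
proof -
  have "u = 0" if u: "u \<in> normal_cone_at C x" for u
  proof (rule ccontr)
    assume "u \<noteq> 0"
    obtain e where e: "e > 0" "cball x e \<subseteq> C"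
      using assms mem_interior_cball by blast
    have "x + (e / norm u) *\<^sub>R u \<in> C"
      using e \<open>u \<noteq> 0\<close> by (intro subsetD[OF e(2)]) (simp add: dist_norm)
    from normal_cone_atD[OF u this] have "(e / norm u) * (u \<bullet> u) \<le> 0"
      by (simp add: inner_add_right)
    moreover have "(e / norm u) * (u \<bullet> u) > 0"
      using e \<open>u \<noteq> 0\<close> by simp
    ultimately show False by simp
  qed
  then show ?thesis
    using zero_in_normal_cone_at by blast
qed

text \<open>Only a singleton has the whole space as normal cone at a point: test against \<open>u = y - x\<close>.\<close>

lemma normal_cone_at_neq_UNIV:
  fixes C :: "'a::euclidean_space set"
  assumes "interior C \<noteq> {}"
  shows "normal_cone_at C x \<noteq> UNIV"
proof
  assume "normal_cone_at C x = UNIV"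
  then have "(y - x) \<bullet> (y - x) \<le> 0" if "y \<in> C" for y
    using that unfolding normal_cone_at_def by blast
  then have "y = x" if "y \<in> C" for y
    using that inner_gt_zero_iff[of "y - x"] by (metis eq_iff_diff_eq_0 not_less)
  then have "C \<subseteq> {x}"
    by blast
  then have "interior C \<subseteq> interior {x}"
    by (rule interior_mono)
  with assms show False by simp
qed

text \<open>The exposing linear form on the larger cone is \<open>u \<mapsto> \<langle>u, x - y\<rangle>\<close>.\<close>

lemma normal_cone_at_subset_exposed_face:
  assumes "x \<in> C" "y \<in> C" and sub: "normal_cone_at C x \<subseteq> normal_cone_at C y"
  shows "normal_cone_at C x exposed_face_of normal_cone_at C y"
proof -
  have eq: "normal_cone_at C x = normal_cone_at C y \<inter> {u. (x - y) \<bullet> u = 0}"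
  proof (intro set_eqI iffI)
    fix u assume u: "u \<in> normal_cone_at C x"
    moreover have "u \<bullet> x = u \<bullet> y"
      using normal_cone_atD[OF u assms(2)] normal_cone_atD[OF subsetD[OF sub u] assms(1)]
      by simp
    ultimately show "u \<in> normal_cone_at C y \<inter> {u. (x - y) \<bullet> u = 0}"
      using sub by (auto simp: inner_commute[of "x - y"] inner_diff_right)
  next
    fix u assume "u \<in> normal_cone_at C y \<inter> {u. (x - y) \<bullet> u = 0}"
    then have "u \<in> normal_cone_at C y" "u \<bullet> x = u \<bullet> y"
      by (auto simp: inner_commute[of "x - y"] inner_diff_right)
    then show "u \<in> normal_cone_at C x"
      by (auto intro!: normal_cone_atI dest: normal_cone_atD)
  qed
  have "(x - y) \<bullet> u \<le> 0" if "u \<in> normal_cone_at C y" for u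
    using normal_cone_atD[OF that assms(1)] by (simp add: inner_commute[of "x - y"] inner_diff_right)
  then show ?thesis
    unfolding eq by (intro exposed_face_of_Int_supporting_hyperplane_le convex_normal_cone_at)
qed

section \<open>Exposed faces and supporting hyperplanes\<close>

lemma exposed_face_subset: "F exposed_face_of C \<Longrightarrow> F \<subseteq> C"
  by (auto simp: exposed_face_of_def dest: face_of_imp_subset)

lemma exposed_face_convex: "F exposed_face_of C \<Longrightarrow> convex F"
  by (auto simp: exposed_face_of_def dest: face_of_imp_convex)

lemma supporting_hyperplane_exposed_face:
  assumes "convex C" "u \<in> normal_cone_at C x"
  shows "(C \<inter> {z. u \<bullet> z = u \<bullet> x}) exposed_face_of C"
  using assms by (intro exposed_face_of_Int_supporting_hyperplane_le) (auto dest: normal_cone_atD)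

lemma supporting_hyperplane_neq:
  fixes C :: "'a::euclidean_space set"
  assumes "interior C \<noteq> {}" "u \<noteq> 0"
  shows "C \<inter> {z. u \<bullet> z = b} \<noteq> C"
proof
  assume "C \<inter> {z. u \<bullet> z = b} = C"
  then have "interior C \<subseteq> interior {z. u \<bullet> z = b}"
    by (intro interior_mono) blast
  with assms show False
    by (simp add: interior_hyperplane)
qed

lemma proper_exposed_face_normal:
  assumes "F exposed_face_of C" "F \<noteq> {}" "F \<noteq> C"
  obtains a where "a \<noteq> 0" "\<And>x. x \<in> F \<Longrightarrow> a \<in> normal_cone_at C x"
    "\<And>x. x \<in> F \<Longrightarrow> F = C \<inter> {z. a \<bullet> z = a \<bullet> x}"
proof -
  obtain a b where ab: "C \<subseteq> {x. a \<bullet> x \<le> b}" "F = C \<inter> {x. a \<bullet> x = b}"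
    using assms(1) unfolding exposed_face_of_def by blast
  show ?thesis
  proof (rule that)
    show "a \<noteq> 0"
      using ab assms(2,3) by auto
  qed (use ab in \<open>auto intro!: normal_cone_atI\<close>)
qed

text \<open>An exposed face can be recovered from its normal cone, hence the map from exposed faces to
  normal cones is injective.\<close>

lemma exposed_face_eq_points_above:
  assumes "F exposed_face_of C" "convex F" "x \<in> rel_interior F"
  shows "F = {y \<in> C. normal_cone_at C x \<subseteq> normal_cone_at C y}"
proof (intro set_eqI iffI)
  have FC: "F \<subseteq> C" and xF: "x \<in> F"
    using assms exposed_face_subset rel_interior_subset by auto
  {
    fix y assume "y \<in> F"
    then show "y \<in> {y \<in> C. normal_cone_at C x \<subseteq> normal_cone_at C y}"
      using normal_cone_at_rel_interior_subset[OF assms(2) FC assms(3)] FC by blast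
  next
    fix y assume y: "y \<in> {y \<in> C. normal_cone_at C x \<subseteq> normal_cone_at C y}"
    obtain a b where ab: "C \<subseteq> {x. a \<bullet> x \<le> b}" "F = C \<inter> {x. a \<bullet> x = b}"
      using assms(1) unfolding exposed_face_of_def by blast
    then have "a \<in> normal_cone_at C x"
      using xF by (auto intro!: normal_cone_atI)
    then have "a \<in> normal_cone_at C y"
      using y by blast
    with xF FC have "a \<bullet> x \<le> a \<bullet> y"
      by (auto dest: normal_cone_atD)
    with ab xF y show "y \<in> F" by fastforce
  }
qed

lemma normal_cone_exposed_face:
  assumes "convex C" "F exposed_face_of C" "F \<noteq> {}"
  obtains x where "x \<in> rel_interior F" "x \<in> F" "normal_cone C F = normal_cone_at C x"
proof -
  have F: "convex F" "F \<subseteq> C"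
    using assms(2) by (rule exposed_face_convex, rule exposed_face_subset)
  then obtain x where "x \<in> rel_interior F"
    using assms(3) rel_interior_eq_empty by blast
  then show ?thesis
    using that normal_cone_eq[OF F] rel_interior_subset by blast
qed

lemma normal_cone_inj:
  assumes "convex C" "F exposed_face_of C" "F \<noteq> {}" "G exposed_face_of C" "G \<noteq> {}"
    and eq: "normal_cone C F = normal_cone C G"
  shows "F = G"
proof -
  obtain x where x: "x \<in> rel_interior F" "normal_cone C F = normal_cone_at C x"
    using normal_cone_exposed_face[OF assms(1-3)] .
  obtain y where y: "y \<in> rel_interior G" "normal_cone C G = normal_cone_at C y"
    using normal_cone_exposed_face[OF assms(1,4,5)] .
  have "F = {z \<in> C. normal_cone_at C x \<subseteq> normal_cone_at C z}"
    "G = {z \<in> C. normal_cone_at C y \<subseteq> normal_cone_at C z}"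
    by (rule exposed_face_eq_points_above[OF assms(2) exposed_face_convex[OF assms(2)] x(1)],
        rule exposed_face_eq_points_above[OF assms(4) exposed_face_convex[OF assms(4)] y(1)])
  then show ?thesis
    using x y eq by simp
qed

section \<open>Proper normal cones and atoms\<close>

lemma proper_normal_cone_iff:
  fixes C :: "'a::euclidean_space set"
  assumes "convex C" "interior C \<noteq> {}"
  shows "proper_normal_cone C N \<longleftrightarrow> (\<exists>x\<in>C. N = normal_cone_at C x \<and> N \<noteq> {0})"
proof -
  obtain x where "x \<in> interior C"
    using assms by blast
  then have "normal_cone C C = {0}"
    using assms normal_cone_eq[of C C x] normal_cone_at_interior[of x C]
      interior_subset_rel_interior by blast
  then show ?thesis
    using normal_cone_at_neq_UNIV[OF assms(2)]
    unfolding proper_normal_cone_def normal_cones_def by (auto simp: normal_cone_def)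
qed

text \<open>A proper exposed face is needed to exclude that the whole space, as the normal cone of the
  empty face, is an atom.\<close>

lemma normal_cone_atom_proper:
  fixes C :: "'a::euclidean_space set"
  assumes "proper_convex C" and atom: "normal_cone_atom C N"
  shows "proper_normal_cone C N"
proof -
  have C: "convex C" "interior C \<noteq> {}"
    using assms(1) by (auto simp: proper_convex_def)
  obtain F where F: "F exposed_face_of C" "F \<noteq> {}" "F \<noteq> C"
    using assms(1) by (auto simp: proper_convex_def proper_exposed_face_def exposed_faces_def)
  then obtain a x where a: "a \<noteq> 0" "a \<in> normal_cone_at C x" "x \<in> F"
    by (metis proper_exposed_face_normal ex_in_conv)
  have "x \<in> C"
    using a F exposed_face_subset by blast
  with a have "normal_cone_at C x \<in> normal_cones C - {{0}}"
    by (auto simp: normal_cones_def)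
  then have "N \<noteq> UNIV"
    using atom normal_cone_at_neq_UNIV[OF C(2)] unfolding normal_cone_atom_def by blast
  then show ?thesis
    using atom unfolding proper_normal_cone_iff[OF C] normal_cone_atom_def normal_cones_def
    by (auto simp: normal_cone_def)
qed

text \<open>A nonzero normal cone below \<open>N\<close> of least dimension is an atom, because a strictly smaller
  normal cone would be a proper face of it and so have smaller dimension.\<close>

lemma normal_cone_atom_below:
  fixes C :: "'a::euclidean_space set"
  assumes "convex C" "interior C \<noteq> {}" "proper_normal_cone C N"
  obtains M where "normal_cone_atom C M" "M exposed_face_of N"
proof -
  obtain x where x: "x \<in> C" "N = normal_cone_at C x" "N \<noteq> {0}"
    using assms(3) unfolding proper_normal_cone_iff[OF assms(1,2)] by blast
  define S where "S = {y \<in> C. normal_cone_at C y \<subseteq> N \<and> normal_cone_at C y \<noteq> {0}}"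
  \<comment> \<open>The affine dimension of a nonempty set is a nonnegative integer, so \<open>nat\<close> is faithful here.\<close>
  define d where "d y = nat (aff_dim (normal_cone_at C y))" for y
  have "x \<in> S"
    using x by (simp add: S_def)
  then obtain y where y: "y \<in> S" and min: "\<And>z. z \<in> S \<Longrightarrow> d y \<le> d z"
    using ex_has_least_nat[of "\<lambda>z. z \<in> S" x d] by blast
  have "normal_cone_at C z = normal_cone_at C y"
    if "z \<in> C" "normal_cone_at C z \<noteq> {0}" and sub: "normal_cone_at C z \<subseteq> normal_cone_at C y" for z
  proof (rule ccontr)
    assume neq: "normal_cone_at C z \<noteq> normal_cone_at C y"
    have "normal_cone_at C z face_of normal_cone_at C y"
      using normal_cone_at_subset_exposed_face[OF _ _ sub] that y
      by (simp add: S_def exposed_face_of_def)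
    then have "aff_dim (normal_cone_at C z) < aff_dim (normal_cone_at C y)"
      using neq by (intro face_of_aff_dim_lt convex_normal_cone_at)
    moreover have "aff_dim (normal_cone_at C z) \<ge> 0"
      using zero_in_normal_cone_at[of C z] aff_dim_negative_iff[of "normal_cone_at C z"]
      by (metis empty_iff not_less)
    ultimately have "d z < d y"
      by (simp add: d_def)
    moreover have "z \<in> S"
      using that y by (auto simp: S_def)
    ultimately show False
      using min by fastforce
  qed
  moreover have "\<not> UNIV \<subseteq> normal_cone_at C y"
    using normal_cone_at_neq_UNIV[OF assms(2)] by blast
  ultimately have "normal_cone_atom C (normal_cone_at C y)"
    using y unfolding normal_cone_atom_def normal_cones_def S_def
    by (auto simp: normal_cone_def)
  moreover have "normal_cone_at C y exposed_face_of N"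
    using x y normal_cone_at_subset_exposed_face[of y C x] by (auto simp: S_def)
  ultimately show ?thesis
    using that by blast
qed

lemma ray_normal_cone:
  fixes C :: "'a::euclidean_space set"
  assumes "R \<in> normal_cones C" "is_ray R"
  obtains v y where "v \<noteq> 0" "y \<in> C" "R = {\<alpha> *\<^sub>R v |\<alpha>. 0 \<le> \<alpha>}" "R = normal_cone_at C y"
    "v \<in> normal_cone_at C y"
proof -
  obtain v where v: "v \<noteq> 0" "R = {\<alpha> *\<^sub>R v |\<alpha>. 0 \<le> \<alpha>}"
    using assms(2) by (auto simp: is_ray_def)
  have "- v \<notin> R"
  proof
    assume "- v \<in> R"
    then obtain \<alpha> where "0 \<le> \<alpha>" "- v = \<alpha> *\<^sub>R v"
      using v(2) by blast
    then have "(\<alpha> + 1) *\<^sub>R v = 0"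
      by (simp add: scaleR_left_distrib) (metis add.left_inverse)
    with \<open>0 \<le> \<alpha>\<close> v(1) show False by simp
  qed
  then obtain y where "y \<in> C" "R = normal_cone_at C y"
    using assms(1) by (auto simp: normal_cones_def normal_cone_def)
  moreover have "v \<in> R"
    unfolding v(2) by (auto intro!: exI[of _ 1])
  ultimately show ?thesis
    using that v by blast
qed

lemma class_C0_iff_atoms_rays:
  fixes C :: "'a::euclidean_space set"
  assumes "proper_convex C"
  shows "C \<in> class_C0 \<longleftrightarrow> (\<forall>N. normal_cone_atom C N \<longrightarrow> is_ray N)"
proof
  have C: "convex C" "interior C \<noteq> {}"
    using assms by (auto simp: proper_convex_def)
  {
    assume C0: "C \<in> class_C0"
    show "\<forall>N. normal_cone_atom C N \<longrightarrow> is_ray N"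
    proof (intro allI impI)
      fix N assume N: "normal_cone_atom C N"
      then obtain R where R: "exposed_ray N R" "R \<in> normal_cones C"
        using normal_cone_atom_proper[OF assms] C0 by (auto simp: class_C0_def)
      then have "R \<subseteq> N" "is_ray R"
        using exposed_face_subset by (auto simp: exposed_ray_def exposed_faces_def)
      moreover have "R \<noteq> {0}"
        using ray_normal_cone[OF R(2) \<open>is_ray R\<close>] by blast
      ultimately show "is_ray N"
        using N R(2) unfolding normal_cone_atom_def by blast
    qed
  next
    assume rays: "\<forall>N. normal_cone_atom C N \<longrightarrow> is_ray N"
    have "\<exists>R. exposed_ray N R \<and> R \<in> normal_cones C" if N: "proper_normal_cone C N" for N
    proof -
      obtain M where M: "normal_cone_atom C M" "M exposed_face_of N"
        using normal_cone_atom_below[OF C N] .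
      then have "exposed_ray N M"
        using rays by (simp add: exposed_ray_def exposed_faces_def)
      moreover have "M \<in> normal_cones C"
        using M(1) by (simp add: normal_cone_atom_def)
      ultimately show ?thesis by blast
    qed
    then show "C \<in> class_C0"
      using assms by (simp add: class_C0_def)
  }
qed

section \<open>Coatoms and rays\<close>

text \<open>The empty face is not a coatom, because there is a proper exposed face above it.\<close>

lemma exposed_face_coatomD:
  assumes "proper_convex C" "exposed_face_coatom C F"
  shows "F exposed_face_of C" "F \<noteq> {}" "F \<noteq> C"
  using assms by (auto simp: proper_convex_def proper_exposed_face_def exposed_face_coatom_def
      exposed_faces_def)

text \<open>The ray \<open>R\<close> supplied by the class assumption is the normal cone at some \<open>y\<close>. Its hyperplane
  through \<open>y\<close> exposes a face containing the coatom \<open>F\<close>, so that \<open>y\<close> lies in \<open>F\<close>; the normal cone of \<open>F\<close>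
  is then contained in that at \<open>y\<close>, which is \<open>R\<close>.\<close>

lemma normal_cone_coatom_ray:
  fixes C :: "'a::euclidean_space set"
  assumes "C \<in> class_C0" and coatom: "exposed_face_coatom C F"
  shows "normal_cone C F \<in> normal_cones C" "is_ray (normal_cone C F)"
proof -
  have pC: "proper_convex C"
    using assms(1) by (simp add: class_C0_def)
  then have C: "convex C" "interior C \<noteq> {}"
    by (auto simp: proper_convex_def)
  note F = exposed_face_coatomD[OF pC coatom]
  have FC: "F \<subseteq> C" "convex F"
    using F(1) exposed_face_subset exposed_face_convex by auto
  obtain x where x: "x \<in> rel_interior F" "x \<in> F" and Nx: "normal_cone C F = normal_cone_at C x"
    using normal_cone_exposed_face[OF C(1) F(1,2)] .
  obtain a where "a \<noteq> 0" "a \<in> normal_cone_at C x"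
    using proper_exposed_face_normal[OF F] x(2) by metis
  then have proper: "proper_normal_cone C (normal_cone C F)"
    unfolding proper_normal_cone_iff[OF C] Nx using x(2) FC by blast
  then show "normal_cone C F \<in> normal_cones C"
    by (simp add: proper_normal_cone_def)
  obtain R where R: "exposed_ray (normal_cone C F) R" "R \<in> normal_cones C"
    using proper assms(1) by (auto simp: class_C0_def)
  then have RN: "R \<subseteq> normal_cone_at C x" and ray: "is_ray R"
    using exposed_face_subset Nx by (auto simp: exposed_ray_def exposed_faces_def)
  obtain v y where v: "v \<noteq> 0" "y \<in> C" "R = normal_cone_at C y" "v \<in> normal_cone_at C y"
    using ray_normal_cone[OF R(2) ray] by metis
  let ?G = "C \<inter> {z. v \<bullet> z = v \<bullet> y}"
  have "F \<subseteq> ?G"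
  proof
    fix z assume z: "z \<in> F"
    then have "v \<in> normal_cone_at C z"
      using normal_cone_at_rel_interior_subset[OF FC(2,1) x(1) z] RN v by blast
    then have "v \<bullet> y \<le> v \<bullet> z"
      using v by (auto dest: normal_cone_atD)
    moreover have "v \<bullet> z \<le> v \<bullet> y"
      using z FC v by (auto dest: normal_cone_atD)
    ultimately show "z \<in> ?G"
      using z FC by auto
  qed
  moreover have "?G \<in> exposed_faces C - {C}"
    using supporting_hyperplane_exposed_face[OF C(1) v(4)] supporting_hyperplane_neq[OF C(2) v(1)]
    by (simp add: exposed_faces_def)
  ultimately have "?G = F"
    using coatom unfolding exposed_face_coatom_def by blast
  with v have "y \<in> F"
    by blast
  then have "normal_cone_at C x \<subseteq> R"
    using normal_cone_at_rel_interior_subset[OF FC(2,1) x(1)] v by blast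
  with RN ray Nx show "is_ray (normal_cone C F)"
    by simp
qed

text \<open>The face in question is exposed by a generator \<open>v\<close> of the ray; any other exposed face above it
  has a normal vector in the same ray and is hence exposed by the same hyperplane.\<close>

lemma ray_normal_cone_of_coatom:
  fixes C :: "'a::euclidean_space set"
  assumes C: "convex C" "interior C \<noteq> {}" and N: "N \<in> normal_cones C" "is_ray N"
  obtains G where "exposed_face_coatom C G" "normal_cone C G = N"
proof -
  obtain v y where v: "v \<noteq> 0" "y \<in> C" "v \<in> normal_cone_at C y"
    and Nv: "N = {\<alpha> *\<^sub>R v |\<alpha>. 0 \<le> \<alpha>}" and Ny: "N = normal_cone_at C y"
    by (rule ray_normal_cone[OF N])
  define G where "G = C \<inter> {z. v \<bullet> z = v \<bullet> y}"
  have G: "G exposed_face_of C" "G \<noteq> C" "y \<in> G"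
    using supporting_hyperplane_exposed_face[OF C(1) v(3)] supporting_hyperplane_neq[OF C(2) v(1)] v
    by (auto simp: G_def)
  obtain x where x: "x \<in> rel_interior G" "x \<in> G" and Nx: "normal_cone C G = normal_cone_at C x"
    using normal_cone_exposed_face[OF C(1) G(1)] G(3) by blast
  have "normal_cone_at C x \<subseteq> N"
    unfolding Ny using G x
    by (intro normal_cone_at_rel_interior_subset[of G] exposed_face_convex
        exposed_face_subset)
  moreover have "v \<in> normal_cone_at C x"
    using x(2) v(3) by (auto simp: G_def intro!: normal_cone_atI dest: normal_cone_atD)
  then have "N \<subseteq> normal_cone_at C x"
    unfolding Nv by (auto intro: scaleR_in_normal_cone_at)
  ultimately have "normal_cone C G = N"
    using Nx by simp
  moreover have "H = G" if H: "H exposed_face_of C" "H \<noteq> C" "G \<subseteq> H" for H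
  proof -
    have yH: "y \<in> H"
      using G H by blast
    then have "H \<noteq> {}"
      by blast
    then obtain a where a: "a \<noteq> 0" "a \<in> normal_cone_at C y" "H = C \<inter> {z. a \<bullet> z = a \<bullet> y}"
      by (rule proper_exposed_face_normal[OF H(1) _ H(2)]) (use yH in blast)
    then obtain \<alpha> where "a = \<alpha> *\<^sub>R v" "\<alpha> \<noteq> 0"
      using Nv Ny by auto
    with a(3) show ?thesis
      by (simp add: G_def)
  qed
  then have "exposed_face_coatom C G"
    using G by (simp add: exposed_face_coatom_def exposed_faces_def)
  ultimately show ?thesis
    using that by blast
qed

lemma normal_cone_bij_coatoms_rays:
  fixes C :: "'a::euclidean_space set"
  assumes "C \<in> class_C0"
  shows "bij_betw (normal_cone C) {F. exposed_face_coatom C F} {N \<in> normal_cones C. is_ray N}"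
proof -
  have pC: "proper_convex C"
    using assms by (simp add: class_C0_def)
  then have C: "convex C" "interior C \<noteq> {}"
    by (auto simp: proper_convex_def)
  show ?thesis
  proof (rule bij_betw_imageI)
    show "inj_on (normal_cone C) {F. exposed_face_coatom C F}"
    proof (rule inj_onI)
      fix F G assume "F \<in> {F. exposed_face_coatom C F}" "G \<in> {F. exposed_face_coatom C F}"
        and eq: "normal_cone C F = normal_cone C G"
      then have "exposed_face_coatom C F" "exposed_face_coatom C G"
        by auto
      then show "F = G"
        using normal_cone_inj[OF C(1) _ _ _ _ eq] exposed_face_coatomD[OF pC] by blast
    qed
    show "normal_cone C ` {F. exposed_face_coatom C F} = {N \<in> normal_cones C. is_ray N}"
    proof (intro equalityI subsetI)
      fix N assume "N \<in> normal_cone C ` {F. exposed_face_coatom C F}"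
      then show "N \<in> {N \<in> normal_cones C. is_ray N}"
        using normal_cone_coatom_ray[OF assms] by auto
    next
      fix N assume "N \<in> {N \<in> normal_cones C. is_ray N}"
      then have N: "N \<in> normal_cones C" "is_ray N"
        by auto
      show "N \<in> normal_cone C ` {F. exposed_face_coatom C F}"
        using ray_normal_cone_of_coatom[OF C N] by blast
    qed
  qed
qed

theorem theorem3p2:
  fixes C :: "(real ^ 'm) set"
  assumes "proper_convex C"
  shows "(C \<in> class_C0 \<longleftrightarrow> (\<forall>N. normal_cone_atom C N \<longrightarrow> is_ray N)) \<and>
    (C \<in> class_C0 \<longrightarrow>
      bij_betw (normal_cone C) {F. exposed_face_coatom C F} {N \<in> normal_cones C. is_ray N})"
  using class_C0_iff_atoms_rays[OF assms] normal_cone_bij_coatoms_rays by blast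

end
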